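(* Suppose that $a_1>0$, $a_2>0$ and $$\left\{\begin{aligned} &a_1<a_2\le\min\big(2a_1,\,1/2\big)&&\text{if } a_1<1/2,\\ &a_1<a_2\le\min\left[2a_1,\ \frac32\left(a_1+\frac12\right)\right]&&\text{if } a_1\ge 1/2. \end{aligned}\right.$$ Let $\mathcal{A}\subset\mathbb{R}^3$ be the set of all permutations of $(a_2,\,a_1+1/2,\,2a_1)$ and $\mathcal{B}\subset\mathbb{R}^3$ the set of all permutations of $(a_1,\,a_2+1/2,\,2a_2)$. If $(b_1,b_2,b_3)\in\boldsymbol{\Gamma}_+(\mathcal{A}\cup\mathcal{B})$, then $$\Phi(x)={}_2F_3\left[\begin{array}{c} a_1,a_2\\ b_1,b_2,b_3\end{array}\biggr|\,-x^2\right]\ge 0\quad\text{for all } x>0,$$ and the strict inequality $\Phi(x)>0$ holds for all $x>0$ unless $(b_1,b_2,b_3)\in\mathcal{A}\cup\mathcal{B}$.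
   Context: Notation: ${}_2F_3\left[\begin{array}{c} a_1,a_2\\ b_1,b_2,b_3\end{array}\big|\,z\right]=\sum_{n=0}^\infty\frac{(a_1)_n(a_2)_n}{n!\,(b_1)_n(b_2)_n(b_3)_n}z^n$, where $(\alpha)_n=\alpha(\alpha+1)\cdots(\alpha+n-1)$ and $(\alpha)_0=1$. $\mathbb{R}_+=[0,\infty)$. For a set $E\subset\mathbb{R}_+^3$, the Newton polyhedron $\boldsymbol{\Gamma}_+(E)$ is the convex hull of $\bigcup_{\mathbf{x}\in E}(\mathbf{x}+\mathbb{R}_+^3)$. *)

theory Defs
  imports "HOL-Analysis.Analysis"
begin

definition hyp2F3 :: "real \<Rightarrow> real \<Rightarrow> real \<Rightarrow> real \<Rightarrow> real \<Rightarrow> real \<Rightarrow> real" where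
  "hyp2F3 a1 a2 b1 b2 b3 z =
     (\<Sum>n. (pochhammer a1 n * pochhammer a2 n) /
            (fact n * pochhammer b1 n * pochhammer b2 n * pochhammer b3 n) * z ^ n)"

lemma hyp2F3_eq_eval_fps_hypergeo:
  "hyp2F3 a1 a2 b1 b2 b3 z = eval_fps (fps_hypergeo [a1, a2] [b1, b2, b3] 1) z"
  by (simp add: hyp2F3_def eval_fps_def mult_ac)

definition nonneg_orthant :: "(real ^ 3) set" where
  "nonneg_orthant = {y. \<forall>i. 0 \<le> y $ i}"

definition newton_polyhedron :: "(real ^ 3) set \<Rightarrow> (real ^ 3) set" where
  "newton_polyhedron E = convex hull (\<Union>x\<in>E. (\<lambda>y. x + y) ` nonneg_orthant)"

definition coord_permutations :: "real ^ 3 \<Rightarrow> (real ^ 3) set" where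
  "coord_permutations v = {\<chi> i. v $ p i | p. bij p}"

end

theory Submission
  imports Defs
    "HOL-Complex_Analysis.Complex_Analysis"
    "HOL-Computational_Algebra.Fundamental_Theorem_Algebra"
    "HOL-Real_Asymp.Real_Asymp"
begin

text \<open>
  For \<open>c > 0\<close> the series with coefficients \<open>(c)\<^sub>n / (n! (c+1/2)\<^sub>n (2c)\<^sub>n)\<close>
  at \<open>-x\<^sup>2\<close> is the square of a (normalised) Bessel function. The terms of \<open>\<Phi>\<close> differ from it by
  the factor \<open>R\<^sub>n\<close>, the quotient of Pochhammer symbols with numerator parameters
  \<open>a1, a2, c+1/2, 2c\<close> and denominator parameters \<open>c, b1, b2, b3\<close>. If \<open>R\<close> is the moment sequence
  of a probability measure \<open>\<mu>\<close> on \<open>[0,1]\<close>, then \<open>\<Phi>\<close> is a \<open>\<mu>\<close>-average of squares.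
  This is the case as soon as \<open>\<Sum> exp(-u \<beta>) \<le> \<Sum> exp(-u \<alpha>)\<close> for all \<open>u > 0\<close>, where \<open>\<alpha>\<close> and \<open>\<beta>\<close> run
  through the numerator and denominator parameters, because then \<open>R\<close> is a limit of moment sequences of
  compound Poisson type. If \<open>b\<close> lies above a convex combination of a point in the hull of \<open>A\<close>
  (weight \<open>l\<close>) and one in the hull of \<open>B\<close>, the inequality holds for \<open>c = l a1 + (1-l) a2\<close>, by weak
  majorization and convexity of \<open>exp\<close>.

  A zero of \<open>\<Phi>\<close> confines \<open>\<mu>\<close> to the isolated zeros of the square, so that \<open>R\<^sub>n - R\<^bsub>n+1\<^esub>\<close>
  decays exponentially. Since \<open>R\<^bsub>n+1\<^esub> / R\<^sub>n\<close> is a rational function of \<open>n\<close> with limit 1, this forces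
  \<open>R\<close> to be constant, and comparing parameters gives \<open>c \<in> {a1, a2}\<close> and \<open>b \<in> A \<union> B\<close>.
\<close>

section \<open>Moment sequences on the unit interval\<close>

text \<open>
  By the Hausdorff moment theorem these are the moment sequences of positive measures on \<open>[0,1]\<close>;
  the functional \<open>f \<mapsto> \<Sum> f\<^sub>n r\<^sub>n\<close> on power series stands in for the integral.
\<close>

definition moment_positive :: "(nat \<Rightarrow> real) \<Rightarrow> bool" where
  "moment_positive r \<longleftrightarrow>
     (\<forall>f. summable (\<lambda>n. \<bar>f n\<bar>) \<longrightarrow> (\<forall>t\<in>{0..1}. 0 \<le> (\<Sum>n. f n * t ^ n)) \<longrightarrow>
        0 \<le> (\<Sum>n. f n * r n))"

lemma moment_positiveD:
  assumes "moment_positive r" "summable (\<lambda>n. \<bar>f n\<bar>)"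
    and "\<And>t. 0 \<le> t \<Longrightarrow> t \<le> 1 \<Longrightarrow> 0 \<le> (\<Sum>n. f n * t ^ n)"
  shows "0 \<le> (\<Sum>n. f n * r n)"
  using assms unfolding moment_positive_def by auto

lemma sums_two_coeffs:
  fixes r :: "nat \<Rightarrow> real"
  assumes "m \<noteq> n"
  shows "(\<lambda>k. (if k = m then a else if k = n then b else 0) * r k) sums (a * r m + b * r n)"
proof -
  have "(\<lambda>k. if k = m then a * r k else 0) sums (a * r m)"
    and "(\<lambda>k. if k = n then b * r k else 0) sums (b * r n)"
    using sums_single[of m "\<lambda>k. a * r k"] sums_single[of n "\<lambda>k. b * r k"] by simp_all
  from sums_add[OF this] show ?thesis
    by (rule sums_cong[THEN iffD1, rotated]) (use assms in auto)
qed

text \<open>Two-term test functions already yield nonnegativity, monotonicity and hence the bound by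
  \<open>r 0\<close>.\<close>

lemma moment_positive_two_coeffs:
  assumes r: "moment_positive r" and "m \<noteq> n"
    and pos: "\<And>t. 0 \<le> t \<Longrightarrow> t \<le> 1 \<Longrightarrow> 0 \<le> a * t ^ m + b * t ^ n"
  shows "0 \<le> a * r m + b * r n"
proof -
  let ?f = "\<lambda>k. if k = m then a else if k = n then b else 0"
  have "summable (\<lambda>k. \<bar>?f k\<bar>)"
    by (rule summable_finite[of "{m, n}"]) auto
  moreover have "0 \<le> (\<Sum>k. ?f k * t ^ k)" if "0 \<le> t" "t \<le> 1" for t
    using sums_two_coeffs[OF \<open>m \<noteq> n\<close>, of a b "\<lambda>k. t ^ k"] pos[OF that]
    by (simp add: sums_iff)
  ultimately have "0 \<le> (\<Sum>k. ?f k * r k)"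
    by (rule moment_positiveD[OF r])
  then show ?thesis
    using sums_two_coeffs[OF \<open>m \<noteq> n\<close>, of a b r] by (simp add: sums_iff)
qed

lemma moment_positive_nonneg:
  assumes "moment_positive r"
  shows "0 \<le> r n"
  using moment_positive_two_coeffs[OF assms, of n "Suc n" 1 0] by simp

lemma moment_positive_antimono:
  assumes "moment_positive r" "m \<le> n"
  shows "r n \<le> r m"
proof (cases "m = n")
  case False
  have "0 \<le> 1 * t ^ m + (-1) * t ^ n" if "0 \<le> t" "t \<le> 1" for t :: real
    using power_decreasing[OF \<open>m \<le> n\<close> that] by simp
  from moment_positive_two_coeffs[OF assms(1) False this] show ?thesis by simp
qed simp

lemma moment_positive_abs_le:
  assumes "moment_positive r"
  shows "\<bar>r n\<bar> \<le> r 0"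
  using moment_positive_nonneg[OF assms, of n] moment_positive_antimono[OF assms, of 0 n] by simp

lemma moment_positive_summable:
  assumes "moment_positive r" "summable (\<lambda>n. \<bar>f n\<bar>)"
  shows "summable (\<lambda>n. \<bar>f n * r n\<bar>)"
proof (rule summable_comparison_test)
  show "summable (\<lambda>n. \<bar>f n\<bar> * r 0)"
    by (rule summable_mult2) fact
  show "\<exists>N. \<forall>n\<ge>N. norm \<bar>f n * r n\<bar> \<le> \<bar>f n\<bar> * r 0"
    using moment_positive_abs_le[OF assms(1)] by (auto simp: abs_mult intro!: mult_left_mono)
qed

lemma moment_positive_summable':
  assumes "moment_positive r" "summable (\<lambda>n. \<bar>f n\<bar>)"
  shows "summable (\<lambda>n. f n * r n)"
  using summable_norm_cancel[of "\<lambda>n. f n * r n"] moment_positive_summable[OF assms] by simp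

lemma moment_positive_power:
  assumes "0 \<le> t" "t \<le> 1"
  shows "moment_positive (\<lambda>n. t ^ n)"
  using assms unfolding moment_positive_def by simp

text \<open>Multiplicative convolution: products of moments are the moments of a product of
  independent variables. As in Fubini, \<open>f\<close> at \<open>t * u\<close> is first tested
  against \<open>s\<close> in \<open>u\<close> with \<open>t\<close> fixed, then against
  \<open>r\<close> in \<open>t\<close>.\<close>

lemma moment_positive_mult:
  assumes r: "moment_positive r" and s: "moment_positive s"
  shows "moment_positive (\<lambda>n. r n * s n)"
  unfolding moment_positive_def
proof (intro allI impI)
  fix f :: "nat \<Rightarrow> real"
  assume sm: "summable (\<lambda>n. \<bar>f n\<bar>)" and pos: "\<forall>t\<in>{0..1}. 0 \<le> (\<Sum>n. f n * t ^ n)"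
  have "0 \<le> (\<Sum>n. (f n * s n) * r n)"
  proof (rule moment_positiveD[OF r moment_positive_summable[OF s sm]])
    fix t :: real assume t: "0 \<le> t" "t \<le> 1"
    have "0 \<le> (\<Sum>n. (f n * t ^ n) * s n)"
    proof (rule moment_positiveD[OF s moment_positive_summable[OF moment_positive_power[OF t] sm]])
      fix u :: real assume u: "0 \<le> u" "u \<le> 1"
      have "0 \<le> (\<Sum>n. f n * (t * u) ^ n)"
        using pos t u by (simp add: mult_le_one)
      then show "0 \<le> (\<Sum>n. f n * t ^ n * u ^ n)"
        by (simp add: power_mult_distrib mult_ac)
    qed
    then show "0 \<le> (\<Sum>n. f n * s n * t ^ n)"
      by (simp add: mult_ac)
  qed
  then show "0 \<le> (\<Sum>n. f n * (r n * s n))"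
    by (simp add: mult_ac)
qed

lemma moment_positive_scale:
  assumes "moment_positive r" "0 \<le> w"
  shows "moment_positive (\<lambda>n. w * r n)"
  unfolding moment_positive_def
proof (intro allI impI)
  fix f :: "nat \<Rightarrow> real"
  assume sm: "summable (\<lambda>n. \<bar>f n\<bar>)" and pos: "\<forall>t\<in>{0..1}. 0 \<le> (\<Sum>n. f n * t ^ n)"
  have "(\<Sum>n. f n * (w * r n)) = w * (\<Sum>n. f n * r n)"
    using suminf_mult[OF moment_positive_summable'[OF assms(1) sm], of w] by (simp add: mult_ac)
  moreover have "0 \<le> (\<Sum>n. f n * r n)"
    by (rule moment_positiveD[OF assms(1) sm]) (use pos in auto)
  ultimately show "0 \<le> (\<Sum>n. f n * (w * r n))"
    using assms(2) by simp
qed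

lemma moment_positive_add:
  assumes r: "moment_positive r" and s: "moment_positive s"
  shows "moment_positive (\<lambda>n. r n + s n)"
  unfolding moment_positive_def
proof (intro allI impI)
  fix f :: "nat \<Rightarrow> real"
  assume sm: "summable (\<lambda>n. \<bar>f n\<bar>)" and pos: "\<forall>t\<in>{0..1}. 0 \<le> (\<Sum>n. f n * t ^ n)"
  have "(\<Sum>n. f n * (r n + s n)) = (\<Sum>n. f n * r n) + (\<Sum>n. f n * s n)"
    using suminf_add[OF moment_positive_summable'[OF r sm] moment_positive_summable'[OF s sm]]
    by (simp add: algebra_simps)
  moreover have "0 \<le> (\<Sum>n. f n * r n)" "0 \<le> (\<Sum>n. f n * s n)"
    by (rule moment_positiveD[OF _ sm], use r s pos in auto)+
  ultimately show "0 \<le> (\<Sum>n. f n * (r n + s n))"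
    by simp
qed

lemma moment_positive_one: "moment_positive (\<lambda>n. 1)"
  using moment_positive_power[of 1] by simp

lemma moment_positive_sum:
  assumes "finite I" "\<And>i. i \<in> I \<Longrightarrow> moment_positive (r i)"
  shows "moment_positive (\<lambda>n. \<Sum>i\<in>I. r i n)"
  using assms
proof (induction I rule: finite_induct)
  case empty
  then show ?case using moment_positive_scale[OF moment_positive_one, of 0] by simp
qed (simp add: moment_positive_add)

lemma moment_positive_prod:
  assumes "finite I" "\<And>i. i \<in> I \<Longrightarrow> moment_positive (r i)"
  shows "moment_positive (\<lambda>n. \<Prod>i\<in>I. r i n)"
  using assms
  by (induction I rule: finite_induct) (simp_all add: moment_positive_one moment_positive_mult)

text \<open>Since \<open>r N 0\<close> dominates all moments of \<open>r N\<close> and converges in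
  \<open>N\<close>, one constant bounds every \<open>r N n\<close>, and Tannery's theorem passes to
  the limit under the series.\<close>

lemma moment_positive_limit:
  assumes r: "\<And>N. moment_positive (r N)" and lim: "\<And>n. (\<lambda>N. r N n) \<longlonglongrightarrow> s n"
  shows "moment_positive s"
  unfolding moment_positive_def
proof (intro allI impI)
  fix f :: "nat \<Rightarrow> real"
  assume sm: "summable (\<lambda>n. \<bar>f n\<bar>)" and pos: "\<forall>t\<in>{0..1}. 0 \<le> (\<Sum>n. f n * t ^ n)"
  have "convergent (\<lambda>N. r N 0)" using lim by (auto simp: convergent_def)
  then obtain C where C: "\<And>N. norm (r N 0) \<le> C"
    using convergent_imp_Bseq BseqE by metis
  have C': "\<bar>r N n\<bar> \<le> C" for N n
    using C[of N] moment_positive_abs_le[OF r, of N n] by auto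
  have ev: "\<forall>\<^sub>F (n, N) in at_top \<times>\<^sub>F sequentially. norm (f n * r N n) \<le> \<bar>f n\<bar> * C"
    by (rule always_eventually) (use C' in \<open>auto simp: abs_mult intro!: mult_left_mono\<close>)
  have "(\<lambda>N. \<Sum>n. f n * r N n) \<longlonglongrightarrow> (\<Sum>n. f n * s n)"
    using tannerys_theorem[OF tendsto_mult[OF tendsto_const lim] ev summable_mult2[OF sm]]
    by simp
  moreover have "0 \<le> (\<Sum>n. f n * r N n)" for N
    by (rule moment_positiveD[OF r sm]) (use pos in auto)
  ultimately show "0 \<le> (\<Sum>n. f n * s n)"
    by (intro LIMSEQ_le_const) auto
qed

text \<open>Compound Poisson: expanding the exponential mixes the moment sequences of the points
  \<open>t ^ k\<close> with the weights \<open>exp (- w) * w ^ k / fact k\<close>.\<close>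

lemma moment_positive_exp:
  assumes "0 \<le> t" "t \<le> 1" "0 \<le> w"
  shows "moment_positive (\<lambda>n. exp (w * (t ^ n - 1)))"
proof -
  have "moment_positive (\<lambda>n. exp (w * t ^ n))"
  proof (rule moment_positive_limit)
    show "moment_positive (\<lambda>n. \<Sum>k<K. (w ^ k / fact k) * (t ^ k) ^ n)" for K
      using assms
      by (intro moment_positive_sum moment_positive_scale moment_positive_power)
         (auto intro: power_le_one)
    show "(\<lambda>K. \<Sum>k<K. (w ^ k / fact k) * (t ^ k) ^ n) \<longlonglongrightarrow> exp (w * t ^ n)" for n
      using exp_converges[of "w * t ^ n"]
      unfolding sums_def
      by (simp add: power_mult_distrib divide_simps mult.commute flip: power_mult)
  qed
  from moment_positive_scale[OF this, of "exp (- w)"] show ?thesis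
    by (simp add: algebra_simps exp_diff exp_minus divide_simps)
qed

section \<open>Quotients of Pochhammer symbols\<close>

lemma sums_ln_one_minus:
  fixes x :: real
  assumes "0 < x" "x < 1"
  shows "(\<lambda>m. - (x ^ Suc m / real (Suc m))) sums ln (1 - x)"
proof -
  have "(\<lambda>n. - (x ^ n) / of_nat n) sums ln (1 - x)"
    using ln_series'[of "- x"] assms by simp
  then show ?thesis
    using sums_Suc_iff[of "\<lambda>n. - (x ^ n) / real n" "ln (1 - x)"] by simp
qed

text \<open>
  With \<open>q = exp(-h)\<close>, the \<open>q\<close>-shifted factorials replace the Levy--Khintchine integral for the
  logarithm of a Gamma quotient by a series in \<open>q\<^bsup>mn\<^esup> - 1\<close>, whose coefficients are nonnegative
  under the exponential inequality.
\<close>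

lemma q_ratio_sums:
  fixes \<alpha> \<beta> :: "'i \<Rightarrow> real"
  assumes "finite I" "\<And>j. j \<in> I \<Longrightarrow> 0 < \<alpha> j" "\<And>j. j \<in> I \<Longrightarrow> 0 < \<beta> j" "0 < h"
  shows "(\<lambda>m. (\<Sum>j\<in>I. exp (- (h * real (Suc m)) * \<alpha> j) - exp (- (h * real (Suc m)) * \<beta> j))
              / (real (Suc m) * (1 - exp (- h * real (Suc m))))
              * (exp (- h * real (Suc m)) ^ n - 1))
         sums (\<Sum>j\<in>I. \<Sum>i<n. ln (1 - exp (- h * (\<alpha> j + real i))) - ln (1 - exp (- h * (\<beta> j + real i))))"
proof -
  have *: "(\<lambda>m. - (exp (- h * (a + real i)) ^ Suc m / real (Suc m))) sums ln (1 - exp (- h * (a + real i)))"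
    if "a > 0" for a i
    by (rule sums_ln_one_minus) (use that \<open>0 < h\<close> in \<open>auto intro!: mult_pos_pos simp: add_pos_nonneg\<close>)
  have "(\<lambda>m. \<Sum>j\<in>I. \<Sum>i<n. - (exp (- h * (\<alpha> j + real i)) ^ Suc m / real (Suc m))
                          - - (exp (- h * (\<beta> j + real i)) ^ Suc m / real (Suc m)))
     sums (\<Sum>j\<in>I. \<Sum>i<n. ln (1 - exp (- h * (\<alpha> j + real i))) - ln (1 - exp (- h * (\<beta> j + real i))))"
    using assms(2,3) by (intro sums_sum sums_diff *) auto
  moreover have "(\<Sum>j\<in>I. exp (- (h * real (Suc m)) * \<alpha> j) - exp (- (h * real (Suc m)) * \<beta> j))
              / (real (Suc m) * (1 - exp (- h * real (Suc m))))
              * (exp (- h * real (Suc m)) ^ n - 1) =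
       (\<Sum>j\<in>I. \<Sum>i<n. - (exp (- h * (\<alpha> j + real i)) ^ Suc m / real (Suc m))
                          - - (exp (- h * (\<beta> j + real i)) ^ Suc m / real (Suc m)))" (is "?l = ?r") for m
  proof -
    define M where "M = real (Suc m)"
    have M: "M > 0" by (simp add: M_def)
    define y where "y = exp (- h * M)"
    have y: "y \<noteq> 1" using M \<open>0 < h\<close> by (simp add: y_def)
    have pw: "exp (- h * (a + real i)) ^ Suc m = exp (- (h * M) * a) * y ^ i" for a i
      unfolding y_def M_def by (simp add: exp_of_nat_mult[symmetric] exp_add[symmetric] algebra_simps del: power_Suc)
    have "?r = (\<Sum>j\<in>I. \<Sum>i<n. - ((exp (- (h * M) * \<alpha> j) - exp (- (h * M) * \<beta> j)) / M * y ^ i))"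
      unfolding pw M_def[symmetric]
      by (intro sum.cong refl) (simp add: diff_divide_distrib algebra_simps)
    also have "\<dots> = - ((\<Sum>j\<in>I. exp (- (h * M) * \<alpha> j) - exp (- (h * M) * \<beta> j)) / M * (\<Sum>i<n. y ^ i))"
      by (simp add: sum_negf sum_divide_distrib[symmetric] sum_distrib_left[symmetric] sum_distrib_right[symmetric])
    \<comment> \<open>The geometric sum over \<open>i\<close> produces the factor
      \<open>y ^ n - 1\<close>, the shape required by \<open>moment_positive_exp\<close>.\<close>
    also have "(\<Sum>i<n. y ^ i) = - ((y ^ n - 1) / (1 - y))"
      unfolding geometric_sum[OF y] by (metis minus_diff_eq minus_divide_right)
    finally show ?thesis
      unfolding M_def[symmetric] y_def[symmetric] using M y by (simp add: field_simps)
  qed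
  ultimately show ?thesis by (simp only:)
qed

text \<open>The logarithm is the series of \<open>q_ratio_sums\<close>. The hypothesis at
  \<open>u = h * real (Suc m)\<close> makes its weights \<open>w m\<close> nonnegative, so its
  partial sums exponentiate to products of compound Poisson sequences.\<close>

lemma moment_positive_q_ratio:
  fixes \<alpha> \<beta> :: "'i \<Rightarrow> real"
  assumes "finite I" "\<And>j. j \<in> I \<Longrightarrow> 0 < \<alpha> j" "\<And>j. j \<in> I \<Longrightarrow> 0 < \<beta> j" "0 < h"
    and le: "\<And>u. 0 < u \<Longrightarrow> (\<Sum>j\<in>I. exp (- u * \<beta> j)) \<le> (\<Sum>j\<in>I. exp (- u * \<alpha> j))"
  shows "moment_positive (\<lambda>n. \<Prod>j\<in>I. \<Prod>i<n. (1 - exp (- h * (\<alpha> j + real i))) / (1 - exp (- h * (\<beta> j + real i))))"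
proof -
  define w where "w m = (\<Sum>j\<in>I. exp (- (h * real (Suc m)) * \<alpha> j) - exp (- (h * real (Suc m)) * \<beta> j))
              / (real (Suc m) * (1 - exp (- h * real (Suc m))))" for m
  define L where "L n = (\<Sum>j\<in>I. \<Sum>i<n. ln (1 - exp (- h * (\<alpha> j + real i))) - ln (1 - exp (- h * (\<beta> j + real i))))" for n
  have w: "0 \<le> w m" for m
    unfolding w_def using le[of "h * real (Suc m)"] \<open>0 < h\<close>
    by (intro divide_nonneg_nonneg mult_nonneg_nonneg) (auto simp: sum_subtractf)
  have "moment_positive (\<lambda>n. exp (L n))"
  proof (rule moment_positive_limit)
    show "moment_positive (\<lambda>n. \<Prod>m<K. exp (w m * (exp (- h * real (Suc m)) ^ n - 1)))" for K
      using w \<open>0 < h\<close> by (intro moment_positive_prod moment_positive_exp) auto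
    fix n
    have "(\<lambda>m. w m * (exp (- h * real (Suc m)) ^ n - 1)) sums L n"
      unfolding w_def L_def by (rule q_ratio_sums) (use assms in auto)
    then show "(\<lambda>K. \<Prod>m<K. exp (w m * (exp (- h * real (Suc m)) ^ n - 1))) \<longlonglongrightarrow> exp (L n)"
      unfolding sums_def by (simp only: exp_sum[symmetric] finite_lessThan tendsto_exp)
  qed
  moreover have "exp (L n) = (\<Prod>j\<in>I. \<Prod>i<n. (1 - exp (- h * (\<alpha> j + real i))) / (1 - exp (- h * (\<beta> j + real i))))" for n
  proof -
    have "0 < 1 - exp (- h * (a + real i))" if "a > 0" for a i
      using that \<open>0 < h\<close> by (auto intro!: mult_pos_pos simp: add_pos_nonneg)
    then show ?thesis
      unfolding L_def using assms(1-3) by (simp add: exp_sum exp_diff)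
  qed
  ultimately show ?thesis by simp
qed

definition pochhammer_ratio :: "'i set \<Rightarrow> ('i \<Rightarrow> real) \<Rightarrow> ('i \<Rightarrow> real) \<Rightarrow> nat \<Rightarrow> real" where
  "pochhammer_ratio I \<alpha> \<beta> n = (\<Prod>j\<in>I. pochhammer (\<alpha> j) n / pochhammer (\<beta> j) n)"

lemma tendsto_one_minus_exp_ratio:
  fixes a b :: real
  assumes "0 < a" "0 < b"
  shows "(\<lambda>N. (1 - exp (- (1 / real (Suc N)) * a)) / (1 - exp (- (1 / real (Suc N)) * b))) \<longlonglongrightarrow> a / b"
  unfolding divide_inverse[of a b] using assms by real_asymp

text \<open>The limit of \<open>moment_positive_q_ratio\<close> as \<open>h\<close> tends to 0 along
  \<open>1 / real (Suc N)\<close>, taken factor by factor.\<close>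

lemma moment_positive_pochhammer_ratio:
  fixes \<alpha> \<beta> :: "'i \<Rightarrow> real"
  assumes "finite I" "\<And>j. j \<in> I \<Longrightarrow> 0 < \<alpha> j" "\<And>j. j \<in> I \<Longrightarrow> 0 < \<beta> j"
    and "\<And>u. 0 < u \<Longrightarrow> (\<Sum>j\<in>I. exp (- u * \<beta> j)) \<le> (\<Sum>j\<in>I. exp (- u * \<alpha> j))"
  shows "moment_positive (pochhammer_ratio I \<alpha> \<beta>)"
proof (rule moment_positive_limit)
  let ?r = "\<lambda>h n. \<Prod>j\<in>I. \<Prod>i<n. (1 - exp (- h * (\<alpha> j + real i))) / (1 - exp (- h * (\<beta> j + real i)))"
  show "moment_positive (?r (1 / real (Suc N)))" for N
    by (rule moment_positive_q_ratio) (use assms in auto)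
  show "(\<lambda>N. ?r (1 / real (Suc N)) n) \<longlonglongrightarrow> pochhammer_ratio I \<alpha> \<beta> n" for n
    unfolding pochhammer_ratio_def pochhammer_prod prod_dividef[symmetric] atLeast0LessThan
    using assms(2,3)
    by (intro tendsto_prod tendsto_one_minus_exp_ratio) (auto simp: add_pos_nonneg)
qed

section \<open>Zeros of the functional\<close>

text \<open>
  Pointwise \<open>t\<^sup>k (1 - t) \<le> \<eta> + g(t) / m + (1-\<delta>)\<^sup>k\<close>, and the functional vanishes on \<open>g\<close>,
  so the size of \<open>m\<close> does not matter when \<open>\<eta>\<close> tends to 0.
\<close>

lemma moment_positive_zero_decay:
  assumes r: "moment_positive r" "r 0 = 1" and sm: "summable (\<lambda>n. \<bar>f n\<bar>)"
    and zero: "(\<Sum>n. f n * r n) = 0"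
    and g: "\<And>t. t \<in> {0..1} \<Longrightarrow> 0 \<le> (\<Sum>n. f n * t ^ n)"
    and cont: "continuous_on {0..1} (\<lambda>t. \<Sum>n. f n * t ^ n)"
    and \<delta>: "0 < \<delta>" "\<delta> < 1" and pos: "\<And>t. t \<in> {1 - \<delta>..<1} \<Longrightarrow> 0 < (\<Sum>n. f n * t ^ n)"
  shows "r k - r (Suc k) \<le> (1 - \<delta>) ^ k"
proof (rule field_le_epsilon)
  fix \<eta> :: real assume \<eta>: "0 < \<eta>"
  let ?g = "\<lambda>t. \<Sum>n. f n * t ^ n"
  \<comment> \<open>A positive minimum by compactness; the interval stops at
    \<open>1 - \<eta>\<close> because \<open>?g\<close> may vanish at 1.\<close>
  have "\<exists>m>0. \<forall>t\<in>{1-\<delta>..1-\<eta>}. m \<le> ?g t"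
  proof (cases "{1-\<delta>..1-\<eta>} = {}")
    case False
    have "continuous_on {1-\<delta>..1-\<eta>} ?g"
      by (rule continuous_on_subset[OF cont]) (use \<eta> \<delta> in auto)
    from continuous_attains_inf[OF compact_Icc False this]
    obtain t0 where "t0 \<in> {1-\<delta>..1-\<eta>}" "\<forall>t\<in>{1-\<delta>..1-\<eta>}. ?g t0 \<le> ?g t" by blast
    then show ?thesis using pos[of t0] \<eta> by auto
  qed (auto intro: exI[of _ 1])
  then obtain m where m: "0 < m" "\<And>t. t \<in> {1-\<delta>..1-\<eta>} \<Longrightarrow> m \<le> ?g t" by blast
  \<comment> \<open>The coefficients of
    \<open>?g t / m + \<eta> + (1-\<delta>)^k - t ^ k * (1 - t)\<close>, which will be the test
    function.\<close>
  define F where "F n = f n / m + (if n = 0 then \<eta> + (1-\<delta>)^k else 0)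
                       + (if n = k then - 1 else 0) + (if n = Suc k then 1 else 0)" for n
  have F_sums: "(\<lambda>n. F n * s n) sums ((\<Sum>n. f n * s n) / m + (\<eta> + (1-\<delta>)^k) * s 0 + - 1 * s k + 1 * s (Suc k))"
    if "summable (\<lambda>n. f n * s n)" for s
  proof -
    have single: "(\<lambda>n. (if n = i then c else 0) * s n) sums (c * s i)" for i and c :: real
      using sums_single[of i "\<lambda>n. c * s n"] by (rule sums_cong[THEN iffD1, rotated]) auto
    have "(\<lambda>n. f n * s n / m + (if n = 0 then \<eta> + (1-\<delta>)^k else 0) * s n
             + (if n = k then - 1 else 0) * s n + (if n = Suc k then 1 else 0) * s n)
          sums ((\<Sum>n. f n * s n) / m + (\<eta> + (1-\<delta>)^k) * s 0 + - 1 * s k + 1 * s (Suc k))"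
      by (intro sums_add single sums_divide summable_sums that)
    then show ?thesis
      by (simp only: F_def distrib_right times_divide_eq_left)
  qed
  have "summable (\<lambda>n. \<bar>F n\<bar>)"
  proof (rule summable_comparison_test_ev)
    show "\<forall>\<^sub>F n in sequentially. norm \<bar>F n\<bar> \<le> \<bar>f n\<bar> / m"
      using eventually_gt_at_top[of "Suc k"] by eventually_elim (use m in \<open>auto simp: F_def\<close>)
    show "summable (\<lambda>n. \<bar>f n\<bar> / m)"
      using sm by (rule summable_divide)
  qed
  then have "0 \<le> (\<Sum>n. F n * r n)"
  proof (rule moment_positiveD[OF r(1)])
    fix t :: real assume t: "0 \<le> t" "t \<le> 1"
    have "(\<Sum>n. F n * t ^ n) = ?g t / m + (\<eta> + (1-\<delta>)^k) - t ^ k * (1 - t)"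
      using sums_unique[OF F_sums[OF moment_positive_summable'[OF moment_positive_power[OF t] sm]]]
      by (simp add: algebra_simps)
    moreover have "t ^ k * (1 - t) \<le> ?g t / m + (\<eta> + (1-\<delta>)^k)"
    proof -
      have tk: "t ^ k \<le> 1" "0 \<le> t ^ k" using t by (auto intro: power_le_one)
      have nn: "0 \<le> (1-\<delta>)^k" "0 \<le> ?g t / m" using \<delta> m g[of t] t by auto
      \<comment> \<open>On the left \<open>t ^ k\<close> is small, on the right \<open>1 - t\<close>
        is small, and in between \<open>?g t / m\<close> is at least 1.\<close>
      consider "t \<le> 1 - \<delta>" | "1 - \<eta> \<le> t" | "t \<in> {1-\<delta>..1-\<eta>}" by fastforce
      then show ?thesis
      proof cases
        case 1
        then have "t ^ k * (1 - t) \<le> (1-\<delta>)^k * 1"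
          using t \<delta> by (intro mult_mono power_mono) auto
        then show ?thesis using nn \<eta> by linarith
      next
        case 2
        then have "t ^ k * (1 - t) \<le> 1 * \<eta>"
          using t tk by (intro mult_mono) auto
        then show ?thesis using nn \<eta> by linarith
      next
        case 3
        then have "1 \<le> ?g t / m" using m by simp
        moreover have "t ^ k * (1 - t) \<le> 1 * 1"
          using t tk by (intro mult_mono) auto
        ultimately show ?thesis using nn \<eta> by linarith
      qed
    qed
    ultimately show "0 \<le> (\<Sum>n. F n * t ^ n)" by simp
  qed
  also have "(\<Sum>n. F n * r n) = (\<eta> + (1-\<delta>)^k) - r k + r (Suc k)"
    using sums_unique[OF F_sums[OF moment_positive_summable'[OF r(1) sm]]] zero r(2) by simp
  finally show "r k - r (Suc k) \<le> (1-\<delta>)^k + \<eta>" by simp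
qed

section \<open>Exponential decay against ratios tending to 1\<close>

text \<open>The quotients \<open>\<rho> ^ k / X k\<close> have successive ratios tending to
  \<open>\<rho>\<close>; the ratio test with the midpoint \<open>c\<close> of \<open>\<rho>\<close>
  and 1 makes them summable, hence null.\<close>

lemma geometric_eventually_less_of_ratio_tendsto_1:
  fixes X :: "nat \<Rightarrow> real"
  assumes pos: "\<And>k. 0 < X k" and lim: "(\<lambda>k. X (Suc k) / X k) \<longlonglongrightarrow> 1" and \<rho>: "0 < \<rho>" "\<rho> < 1"
  shows "\<forall>\<^sub>F k in sequentially. \<rho> ^ k < X k"
proof -
  define c where "c = (\<rho> + 1) / 2"
  have c: "\<rho> < c" "c < 1" "0 < c" using \<rho> by (auto simp: c_def)
  have "\<forall>\<^sub>F k in sequentially. \<rho> / c < X (Suc k) / X k"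
    using lim by (rule order_tendstoD) (use c in simp)
  then obtain N where N: "\<And>k. k \<ge> N \<Longrightarrow> \<rho> / c < X (Suc k) / X k"
    by (auto simp: eventually_sequentially)
  have "summable (\<lambda>k. \<rho> ^ k / X k)"
  proof (rule summable_ratio_test[OF c(2)])
    fix k assume "k \<ge> N"
    from N[OF this] have "\<rho> * X k \<le> c * X (Suc k)"
      using c pos[of k] by (simp add: field_simps)
    then have "\<rho> ^ k * (\<rho> * X k) \<le> \<rho> ^ k * (c * X (Suc k))"
      using \<rho> by (intro mult_left_mono) auto
    then show "norm (\<rho> ^ Suc k / X (Suc k)) \<le> c * norm (\<rho> ^ k / X k)"
      using pos[of k] pos[of "Suc k"] \<rho> by (simp add: field_simps)
  qed
  then have "(\<lambda>k. \<rho> ^ k / X k) \<longlonglongrightarrow> 0"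
    by (rule summable_LIMSEQ_zero)
  then have "\<forall>\<^sub>F k in sequentially. \<rho> ^ k / X k < 1"
    by (rule order_tendstoD) simp
  then show ?thesis
    by eventually_elim (use pos in \<open>simp add: field_simps\<close>)
qed

lemma nonzero_poly_eventually_bounded_below:
  fixes p :: "real poly"
  assumes "p \<noteq> 0"
  shows "\<exists>m>0. \<forall>\<^sub>F k in sequentially. m \<le> \<bar>poly p (real k)\<bar>"
proof (cases p)
  case (pCons a q)
  show ?thesis
  proof (cases "q = 0")
    case True
    then show ?thesis using pCons assms by (intro exI[of _ "\<bar>a\<bar>"]) auto
  next
    case False
    from poly_infinity[OF this, of 1 a]
    obtain B where B: "\<And>z. B \<le> norm z \<Longrightarrow> 1 \<le> norm (poly p z)" using pCons by auto
    have "\<forall>\<^sub>F k in sequentially. nat \<lceil>B\<rceil> \<le> k" by (rule eventually_ge_at_top)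
    then have "\<forall>\<^sub>F k in sequentially. 1 \<le> \<bar>poly p (real k)\<bar>"
      by eventually_elim (use B in \<open>auto simp: nat_le_iff ceiling_le_iff\<close>)
    then show ?thesis by (intro exI[of _ 1]) simp
  qed
qed

lemma pochhammer_ratio_0 [simp]: "pochhammer_ratio I \<alpha> \<beta> 0 = 1"
  by (simp add: pochhammer_ratio_def)

lemma pochhammer_ratio_Suc:
  "pochhammer_ratio I \<alpha> \<beta> (Suc n) =
     pochhammer_ratio I \<alpha> \<beta> n * (\<Prod>j\<in>I. (\<alpha> j + real n) / (\<beta> j + real n))"
  by (simp add: pochhammer_ratio_def pochhammer_Suc prod.distrib[symmetric])

lemma pochhammer_ratio_pos:
  assumes "\<And>j. j \<in> I \<Longrightarrow> 0 < \<alpha> j" "\<And>j. j \<in> I \<Longrightarrow> 0 < \<beta> j"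
  shows "0 < pochhammer_ratio I \<alpha> \<beta> n"
  unfolding pochhammer_ratio_def using assms by (intro prod_pos divide_pos_pos pochhammer_pos ballI) auto

lemma tendsto_prod_shift_ratio:
  fixes \<alpha> \<beta> :: "'i \<Rightarrow> real"
  shows "(\<lambda>n. \<Prod>j\<in>I. (\<alpha> j + real n) / (\<beta> j + real n)) \<longlonglongrightarrow> 1"
proof -
  have "(\<lambda>n. (a + real n) / (b + real n)) \<longlonglongrightarrow> 1" for a b :: real
    by real_asymp
  then have "(\<lambda>n. \<Prod>j\<in>I. (\<alpha> j + real n) / (\<beta> j + real n)) \<longlonglongrightarrow> (\<Prod>j\<in>I. 1)"
    by (intro tendsto_prod)
  then show ?thesis by simp
qed

lemma pochhammer_ratio_zero_functional:
  fixes \<alpha> \<beta> :: "'i \<Rightarrow> real"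
  assumes I: "finite I" and \<alpha>: "\<And>j. j \<in> I \<Longrightarrow> 0 < \<alpha> j" and \<beta>: "\<And>j. j \<in> I \<Longrightarrow> 0 < \<beta> j"
    and mp: "moment_positive (pochhammer_ratio I \<alpha> \<beta>)"
    and sm: "summable (\<lambda>n. \<bar>f n\<bar>)"
    and zero: "(\<Sum>n. f n * pochhammer_ratio I \<alpha> \<beta> n) = 0"
    and g: "\<And>t. t \<in> {0..1} \<Longrightarrow> 0 \<le> (\<Sum>n. f n * t ^ n)"
    and cont: "continuous_on {0..1} (\<lambda>t. \<Sum>n. f n * t ^ n)"
    and \<delta>: "0 < \<delta>" "\<delta> < 1" and pos: "\<And>t. t \<in> {1 - \<delta>..<1} \<Longrightarrow> 0 < (\<Sum>n. f n * t ^ n)"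
  shows "(\<Prod>j\<in>I. \<alpha> j + x) = (\<Prod>j\<in>I. \<beta> j + x)"
proof -
  define R where "R = pochhammer_ratio I \<alpha> \<beta>"
  define P where "P = (\<Prod>j\<in>I. [:\<beta> j, 1:]) - (\<Prod>j\<in>I. [:\<alpha> j, 1:])"
  have P: "poly P y = (\<Prod>j\<in>I. \<beta> j + y) - (\<Prod>j\<in>I. \<alpha> j + y)" for y
    by (simp add: P_def poly_prod)
  have Q: "0 < (\<Prod>j\<in>I. \<beta> j + real k)" for k
    using \<beta> by (intro prod_pos ballI) (simp add: add_pos_nonneg)
  have Rpos: "0 < R k" for k
    unfolding R_def using \<alpha> \<beta> by (rule pochhammer_ratio_pos)
  have D: "R k - R (Suc k) = R k * poly P (real k) / (\<Prod>j\<in>I. \<beta> j + real k)" for k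
    using Q[of k] by (simp add: R_def pochhammer_ratio_Suc P prod_dividef field_simps)
  have "P = 0"
  proof (rule ccontr)
    assume "P \<noteq> 0"
    from nonzero_poly_eventually_bounded_below[OF this]
    obtain m where m: "0 < m" "\<forall>\<^sub>F k in sequentially. m \<le> \<bar>poly P (real k)\<bar>" by blast
    \<comment> \<open>The decrement \<open>R k - R (Suc k)\<close> with its polynomial factor
      replaced by the lower bound \<open>m\<close>; successive ratios of \<open>X\<close> are then
      products of quotients linear in \<open>k\<close>.\<close>
    define X where "X k = R k * m / (\<Prod>j\<in>I. \<beta> j + real k)" for k
    have X: "0 < X k" for k
      using Rpos Q m by (simp add: X_def)
    have "X (Suc k) / X k = (\<Prod>j\<in>I. (\<alpha> j + real k) / (\<beta> j + real k)) *
            (\<Prod>j\<in>I. (\<beta> j + real k) / ((\<beta> j + 1) + real k))" for k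
      using Q[of k] Q[of "Suc k"] Rpos[of k] m(1)
      by (simp add: X_def R_def pochhammer_ratio_Suc prod_dividef field_simps)
    then have "(\<lambda>k. X (Suc k) / X k) \<longlonglongrightarrow> 1"
      using tendsto_mult[OF tendsto_prod_shift_ratio tendsto_prod_shift_ratio] by simp
    from geometric_eventually_less_of_ratio_tendsto_1[OF X this, of "1 - \<delta>"] \<delta>
    have "\<forall>\<^sub>F k in sequentially. (1 - \<delta>) ^ k < X k" by simp
    with m(2) have "\<forall>\<^sub>F k in sequentially. False"
    proof eventually_elim
      case (elim k)
      have "0 \<le> R k - R (Suc k)"
        using moment_positive_antimono[OF mp, of k "Suc k"] by (simp add: R_def)
      then have "0 \<le> poly P (real k)"
        unfolding D using Rpos[of k] Q[of k] by (simp add: zero_le_divide_iff zero_le_mult_iff)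
      with elim(1) have "X k \<le> R k - R (Suc k)"
        unfolding D X_def using Rpos[of k] Q[of k]
        by (intro divide_right_mono mult_left_mono) auto
      also have "\<dots> \<le> (1 - \<delta>) ^ k"
        unfolding R_def
        by (rule moment_positive_zero_decay[OF mp pochhammer_ratio_0 sm zero g cont \<delta> pos])
      finally show False using elim(2) by simp
    qed
    then show False by simp
  qed
  with P[of x] show ?thesis by simp
qed

section \<open>Isolated zeros of the square root series\<close>

text \<open>The series defines an entire function that is nonzero at 0, so its zeros are isolated: a
  punctured neighbourhood of 1 is free of zeros even if 1 is one.\<close>

lemma power_series_nonzero_left_of_1:
  fixes e :: "nat \<Rightarrow> real"
  assumes sm: "\<And>K. summable (\<lambda>n. \<bar>e n * K ^ n\<bar>)" and "e 0 \<noteq> 0"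
  shows "\<exists>\<delta>. 0 < \<delta> \<and> \<delta> < 1 \<and> (\<forall>t\<in>{1 - \<delta>..<1}. (\<Sum>n. e n * t ^ n) \<noteq> 0)"
proof -
  define F :: "complex fps" where "F = Abs_fps (\<lambda>n. of_real (e n))"
  have "fps_conv_radius F = \<infinity>"
    unfolding fps_conv_radius_def
  proof (rule conv_radius_inftyI'')
    fix z :: complex
    have "summable (\<lambda>n. norm (fps_nth F n * z ^ n))"
      using sm[of "norm z"] by (simp add: F_def norm_mult norm_power abs_mult)
    then show "summable (\<lambda>n. fps_nth F n * z ^ n)"
      by (rule summable_norm_cancel)
  qed
  then have hol: "eval_fps F holomorphic_on UNIV"
    by (intro holomorphic_on_eval_fps) auto
  have real: "eval_fps F (of_real t) = of_real (\<Sum>n. e n * t ^ n)" for t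
  proof -
    have "summable (\<lambda>n. e n * t ^ n)"
      using summable_norm_cancel[of "\<lambda>n. e n * t ^ n"] sm[of t] by simp
    then show ?thesis
      unfolding eval_fps_def F_def by (subst suminf_of_real) simp_all
  qed
  have "eval_fps F 0 \<noteq> 0"
    using \<open>e 0 \<noteq> 0\<close> by (simp add: eval_fps_at_0 F_def)
  have "\<forall>\<^sub>F z in at 1. eval_fps F z \<noteq> 0 \<and> z \<in> UNIV"
    by (rule non_zero_neighbour_alt[OF hol]) (use \<open>eval_fps F 0 \<noteq> 0\<close> in auto)
  then obtain d where d: "d > 0" "\<And>z. z \<noteq> 1 \<Longrightarrow> dist z 1 < d \<Longrightarrow> eval_fps F z \<noteq> 0"
    by (auto simp: eventually_at)
  \<comment> \<open>Halving \<open>d\<close> keeps the closed left end strictly within distance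
    \<open>d\<close> of 1; the cap 1/2 keeps \<open>\<delta>\<close> below 1.\<close>
  have "(\<Sum>n. e n * t ^ n) \<noteq> 0" if "t \<in> {1 - min (d/2) (1/2)..<1}" for t
  proof -
    have "dist (complex_of_real t) 1 = \<bar>t - 1\<bar>"
      by (metis dist_norm norm_of_real of_real_1 of_real_diff)
    then have "eval_fps F (of_real t) \<noteq> 0"
      using that d by (intro d(2)) auto
    then show ?thesis unfolding real by simp
  qed
  then show ?thesis
    using d(1) by (intro exI[of _ "min (d/2) (1/2)"]) auto
qed

section \<open>The square of the Bessel series\<close>

text \<open>Chu--Vandermonde for the upper parameter \<open>c + n - 1/2\<close>.\<close>

lemma sum_inverse_fact_pochhammer:
  fixes c :: real
  assumes "0 < c"
  shows "(\<Sum>i\<le>n. 1 / (fact i * pochhammer (c + 1/2) i) * (1 / (fact (n - i) * pochhammer (c + 1/2) (n - i)))) =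
     4 ^ n * pochhammer c n / (fact n * pochhammer (c + 1/2) n * pochhammer (2 * c) n)"
proof -
  define b where "b = c + 1/2"
  have b: "0 < b" using assms by (simp add: b_def)
  have pos: "0 < pochhammer b i" "0 < pochhammer (2 * c) i" for i
    using b assms by (simp_all add: pochhammer_pos)
  \<comment> \<open>Pairing each factorial with the Pochhammer symbol of complementary index turns
    every summand into a product of two generalized binomials with the same upper entry.\<close>
  have *: "1 / (fact i * pochhammer b (n - i)) = ((b + real n - 1) gchoose i) / pochhammer b n" if "i \<le> n" for i
  proof -
    have "pochhammer b n = pochhammer b (n - i) * pochhammer (b + real (n - i)) i"
      using pochhammer_product'[of b "n - i" i] that by simp
    moreover have "((b + real n - 1) gchoose i) = pochhammer (b + real (n - i)) i / fact i"
      using that by (simp add: gbinomial_pochhammer' of_nat_diff algebra_simps)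
    moreover have "0 < pochhammer (b + real (n - i)) i"
      using b by (intro pochhammer_pos) simp
    ultimately show ?thesis
      using pos(1)[of "n - i"] by (simp add: field_simps)
  qed
  have "(\<Sum>i\<le>n. 1 / (fact i * pochhammer b i) * (1 / (fact (n - i) * pochhammer b (n - i)))) =
        (\<Sum>i\<le>n. ((b + real n - 1) gchoose i) / pochhammer b n * (((b + real n - 1) gchoose (n - i)) / pochhammer b n))"
  proof (rule sum.cong[OF refl])
    fix i assume "i \<in> {..n}"
    then have "i \<le> n" by simp
    have "1 / (fact i * pochhammer b i) * (1 / (fact (n - i) * pochhammer b (n - i))) =
          1 / (fact i * pochhammer b (n - i)) * (1 / (fact (n - i) * pochhammer b (n - (n - i))))"
      using \<open>i \<le> n\<close> by simp
    also have "\<dots> = ((b + real n - 1) gchoose i) / pochhammer b n * (((b + real n - 1) gchoose (n - i)) / pochhammer b n)"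
      using \<open>i \<le> n\<close> by (simp only: * diff_le_self)
    finally show "1 / (fact i * pochhammer b i) * (1 / (fact (n - i) * pochhammer b (n - i))) = \<dots>" .
  qed
  also have "\<dots> = (\<Sum>i\<le>n. ((b + real n - 1) gchoose i) * ((b + real n - 1) gchoose (n - i))) / (pochhammer b n)\<^sup>2"
    by (simp add: sum_divide_distrib power2_eq_square)
  also have "(\<Sum>i\<le>n. ((b + real n - 1) gchoose i) * ((b + real n - 1) gchoose (n - i))) =
             (2 * c + real n + real n - 1) gchoose n"
    using gbinomial_Vandermonde[of "b + real n - 1" "b + real n - 1" n]
    by (simp add: atLeast0AtMost b_def algebra_simps)
  also have "\<dots> = pochhammer (2 * c + real n) n / fact n"
    by (simp add: gbinomial_pochhammer' algebra_simps)
  \<comment> \<open>Duplication formula for the Pochhammer symbol of \<open>2 * c\<close> at index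
    \<open>2 * n\<close>, split after the first \<open>n\<close> factors.\<close>
  also have "pochhammer (2 * c + real n) n = 4 ^ n * pochhammer c n * pochhammer b n / pochhammer (2 * c) n"
  proof -
    have "pochhammer (2 * c) n * pochhammer (2 * c + real n) n = 4 ^ n * pochhammer c n * pochhammer b n"
      using pochhammer_product'[of "2 * c" n n] pochhammer_double[of c n]
      unfolding b_def power_mult mult_2[of n, symmetric] by simp
    then show ?thesis
      using pos(2)[of n] by (simp add: field_simps)
  qed
  finally show ?thesis
    unfolding b_def[symmetric] using pos[of n] by (simp add: field_simps power2_eq_square)
qed

lemma summable_0F1:
  fixes b :: real
  assumes "0 < b"
  shows "summable (\<lambda>n. \<bar>y ^ n / (fact n * pochhammer b n)\<bar>)"
proof (rule summable_ratio_test)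
  show "(1/2 :: real) < 1" by simp
  fix n assume n: "n \<ge> nat \<lceil>2 * \<bar>y\<bar> / b\<rceil>"
  then have "2 * \<bar>y\<bar> \<le> real n * b"
    using assms by (simp add: nat_le_iff ceiling_le_iff field_simps)
  also have "\<dots> \<le> real (Suc n) * (b + real n)"
    using assms by (intro mult_mono) auto
  finally have le: "\<bar>y\<bar> / (real (Suc n) * (b + real n)) \<le> 1/2"
    using assms by (subst pos_divide_le_eq) (auto intro!: mult_pos_pos add_pos_nonneg)
  have eq: "\<bar>y ^ Suc n / (fact (Suc n) * pochhammer b (Suc n))\<bar> =
        \<bar>y ^ n / (fact n * pochhammer b n)\<bar> * (\<bar>y\<bar> / (real (Suc n) * (b + real n)))"
    using assms pochhammer_pos[OF assms, of n]
    unfolding pochhammer_Suc fact_Suc power_Suc abs_divide abs_mult by (simp add: mult_ac)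
  show "norm \<bar>y ^ Suc n / (fact (Suc n) * pochhammer b (Suc n))\<bar>
        \<le> 1/2 * norm \<bar>y ^ n / (fact n * pochhammer b n)\<bar>"
    unfolding real_norm_def abs_idempotent unfolding eq mult.commute[of "1/2"]
    by (rule mult_left_mono[OF le abs_ge_zero])
qed

text \<open>For \<open>y = x\<^sup>2\<close>, \<open>e\<close> gives the normalised Bessel function
  of order \<open>c - 1/2\<close> at \<open>x * sqrt t\<close> as a series in \<open>t\<close>; its
  Cauchy square is evaluated by \<open>sum_inverse_fact_pochhammer\<close>.\<close>

lemma square_0F1:
  fixes c y :: real
  assumes "0 < c"
  defines "e \<equiv> \<lambda>n. (- y / 4) ^ n / (fact n * pochhammer (c + 1/2) n)"
    and "f \<equiv> \<lambda>n. pochhammer c n / (fact n * pochhammer (c + 1/2) n * pochhammer (2 * c) n) * (- y) ^ n"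
  shows "summable (\<lambda>n. \<bar>f n\<bar>)" and "(\<Sum>n. f n * t ^ n) = (\<Sum>n. e n * t ^ n)\<^sup>2"
    and "summable (\<lambda>n. \<bar>e n * t ^ n\<bar>)"
proof -
  have sm: "summable (\<lambda>n. \<bar>(z / 4) ^ n / (fact n * pochhammer (c + 1/2) n)\<bar>)" for z
    using assms(1) by (intro summable_0F1) simp
  have e: "e n * t ^ n = ((- y * t) / 4) ^ n / (fact n * pochhammer (c + 1/2) n)" for n t
    unfolding e_def by (simp only: power_mult_distrib[symmetric] times_divide_eq_left)
  show "summable (\<lambda>n. \<bar>e n * t ^ n\<bar>)" for t
    unfolding e by (rule sm)
  have conv: "(\<Sum>i\<le>n. ((z / 4) ^ i / (fact i * pochhammer (c + 1/2) i)) * ((z / 4) ^ (n - i) / (fact (n - i) * pochhammer (c + 1/2) (n - i)))) =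
      pochhammer c n / (fact n * pochhammer (c + 1/2) n * pochhammer (2 * c) n) * z ^ n" for z n
  proof -
    have "(\<Sum>i\<le>n. ((z / 4) ^ i / (fact i * pochhammer (c + 1/2) i)) * ((z / 4) ^ (n - i) / (fact (n - i) * pochhammer (c + 1/2) (n - i)))) =
       (\<Sum>i\<le>n. (z / 4) ^ n * (1 / (fact i * pochhammer (c + 1/2) i) * (1 / (fact (n - i) * pochhammer (c + 1/2) (n - i)))))"
      by (intro sum.cong refl) (simp add: power_add[symmetric])
    also have "\<dots> = (z / 4) ^ n * (4 ^ n * pochhammer c n / (fact n * pochhammer (c + 1/2) n * pochhammer (2 * c) n))"
      unfolding sum_distrib_left[symmetric] sum_inverse_fact_pochhammer[OF assms(1)] ..
    finally show ?thesis by (simp add: power_divide)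
  qed
  have nrm: "summable (\<lambda>n. norm ((z / 4) ^ n / (fact n * pochhammer (c + 1/2) n)))" for z
    using sm[of z] by simp
  \<comment> \<open>Taking absolute values replaces \<open>- y\<close> by
    \<open>\<bar>y\<bar>\<close>, so absolute summability follows from the Cauchy product at
    \<open>\<bar>y\<bar>\<close>.\<close>
  have f: "\<bar>f n\<bar> = pochhammer c n / (fact n * pochhammer (c + 1/2) n * pochhammer (2 * c) n) * \<bar>y\<bar> ^ n" for n
    using assms(1) by (simp add: f_def abs_mult power_abs pochhammer_pos abs_of_pos)
  show "summable (\<lambda>n. \<bar>f n\<bar>)"
    unfolding f using summable_Cauchy_product[OF nrm nrm, of "\<bar>y\<bar>" "\<bar>y\<bar>"] unfolding conv .
  have "f n * t ^ n = pochhammer c n / (fact n * pochhammer (c + 1/2) n * pochhammer (2 * c) n) * (- y * t) ^ n" for n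
    unfolding f_def by (simp only: power_mult_distrib mult.assoc)
  then show "(\<Sum>n. f n * t ^ n) = (\<Sum>n. e n * t ^ n)\<^sup>2"
    using Cauchy_product_sums[OF nrm nrm, of "- y * t" "- y * t"]
    unfolding conv e power2_eq_square by (simp add: sums_iff)
qed

section \<open>The Newton polyhedron and weak majorization\<close>

text \<open>Weak majorization when the thresholds are the partial sums of an increasing vector.
  Bounding all subset sums avoids sorting \<open>v\<close> and keeps the conditions permutation
  invariant and linear in \<open>v\<close>.\<close>

definition sums_dominate :: "real \<Rightarrow> real \<Rightarrow> real \<Rightarrow> real ^ 3 \<Rightarrow> bool" where
  "sums_dominate s1 s2 s3 v \<longleftrightarrow>
     (\<forall>i. s1 \<le> v $ i) \<and> (\<forall>i j. i \<noteq> j \<longrightarrow> s2 \<le> v $ i + v $ j) \<and> s3 \<le> (\<Sum>i\<in>UNIV. v $ i)"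

lemma sums_dominate_vector:
  "sums_dominate s1 s2 s3 (vector [x, y, z]) \<longleftrightarrow>
     s1 \<le> x \<and> s1 \<le> y \<and> s1 \<le> z \<and> s2 \<le> x + y \<and> s2 \<le> x + z \<and> s2 \<le> y + z \<and> s3 \<le> x + y + z"
  by (auto simp: sums_dominate_def forall_3 sum_3 add.commute)

lemma sums_dominate_coord_permutations:
  assumes "sums_dominate s1 s2 s3 v" "x \<in> coord_permutations v"
  shows "sums_dominate s1 s2 s3 x"
proof -
  obtain p where p: "bij p" "x = (\<chi> i. v $ p i)"
    using assms(2) by (auto simp: coord_permutations_def)
  have "(\<Sum>i\<in>UNIV. v $ p i) = (\<Sum>i\<in>UNIV. v $ i)"
    by (rule sum.reindex_bij_betw) (use p in simp)
  then show ?thesis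
    using assms(1) p by (auto simp: sums_dominate_def bij_def inj_eq)
qed

text \<open>The points admitting some such \<open>l\<close> form a convex set \<open>W\<close>. It
  contains the orthants above \<open>A\<close> (\<open>l = 1\<close>) and above \<open>B\<close>
  (\<open>l = 0\<close>), hence their hull.\<close>

lemma newton_polyhedron_sums_dominate:
  assumes v: "v \<in> newton_polyhedron (A \<union> B)"
    and A: "\<And>x. x \<in> A \<Longrightarrow> sums_dominate s1 s2 s3 x"
    and B: "\<And>x. x \<in> B \<Longrightarrow> sums_dominate t1 t2 t3 x"
  obtains l where "0 \<le> l" "l \<le> 1"
    "sums_dominate (l * s1 + (1 - l) * t1) (l * s2 + (1 - l) * t2) (l * s3 + (1 - l) * t3) v"
proof -
  define W where "W = {v. \<exists>l. 0 \<le> l \<and> l \<le> 1 \<and>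
    sums_dominate (l * s1 + (1 - l) * t1) (l * s2 + (1 - l) * t2) (l * s3 + (1 - l) * t3) v}"
  have up: "sums_dominate r1 r2 r3 (x + y)" if "sums_dominate r1 r2 r3 x" "y \<in> nonneg_orthant" for r1 r2 r3 x y
  proof -
    have y: "0 \<le> y $ i" for i using that by (simp add: nonneg_orthant_def)
    have "r1 \<le> x $ i + y $ i" for i
      using that(1) y[of i] unfolding sums_dominate_def by (smt (verit))
    moreover have "r2 \<le> x $ i + y $ i + (x $ j + y $ j)" if "i \<noteq> j" for i j
      using \<open>sums_dominate r1 r2 r3 x\<close> that y[of i] y[of j] unfolding sums_dominate_def by (smt (verit))
    moreover have "r3 \<le> (\<Sum>i\<in>UNIV. x $ i + y $ i)"
      using that(1) sum_nonneg[of UNIV "\<lambda>i. y $ i"] y by (simp add: sums_dominate_def sum.distrib)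
    ultimately show ?thesis by (simp add: sums_dominate_def)
  qed
  have "convex W"
  proof (rule convexI)
    fix x y :: "real ^ 3" and a b :: real
    assume xy: "x \<in> W" "y \<in> W" and ab: "0 \<le> a" "0 \<le> b" "a + b = 1"
    from xy obtain l k where l: "0 \<le> l" "l \<le> 1"
        "sums_dominate (l * s1 + (1 - l) * t1) (l * s2 + (1 - l) * t2) (l * s3 + (1 - l) * t3) x"
      and k: "0 \<le> k" "k \<le> 1"
        "sums_dominate (k * s1 + (1 - k) * t1) (k * s2 + (1 - k) * t2) (k * s3 + (1 - k) * t3) y"
      by (auto simp: W_def)
    \<comment> \<open>The thresholds are affine in the weight, so the weights combine like the
      points.\<close>
    define m where "m = a * l + b * k"
    have m: "0 \<le> m" "m \<le> 1"
      using l k ab convex_bound_le[of l 1 k a b] by (auto simp: m_def)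
    have comb: "m * s + (1 - m) * t \<le> a * X + b * Y"
      if "l * s + (1 - l) * t \<le> X" "k * s + (1 - k) * t \<le> Y" for s t X Y :: real
    proof -
      have "m * s + (1 - m) * t = a * (l * s + (1 - l) * t) + b * (k * s + (1 - k) * t)"
        using ab(3) unfolding m_def by algebra
      also have "\<dots> \<le> a * X + b * Y"
        using that ab by (intro add_mono mult_left_mono) auto
      finally show ?thesis .
    qed
    have "sums_dominate (m * s1 + (1 - m) * t1) (m * s2 + (1 - m) * t2) (m * s3 + (1 - m) * t3)
            (a *\<^sub>R x + b *\<^sub>R y)"
      unfolding sums_dominate_def
    proof (intro conjI allI impI)
      show "m * s1 + (1 - m) * t1 \<le> (a *\<^sub>R x + b *\<^sub>R y) $ i" for i
        using comb[of s1 t1 "x $ i" "y $ i"] l(3) k(3) by (simp add: sums_dominate_def)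
      show "m * s2 + (1 - m) * t2 \<le> (a *\<^sub>R x + b *\<^sub>R y) $ i + (a *\<^sub>R x + b *\<^sub>R y) $ j" if "i \<noteq> j" for i j
        using comb[of s2 t2 "x $ i + x $ j" "y $ i + y $ j"] l(3) k(3) that
        by (simp add: sums_dominate_def algebra_simps)
      show "m * s3 + (1 - m) * t3 \<le> (\<Sum>i\<in>UNIV. (a *\<^sub>R x + b *\<^sub>R y) $ i)"
        using comb[of s3 t3 "\<Sum>i\<in>UNIV. x $ i" "\<Sum>i\<in>UNIV. y $ i"] l(3) k(3)
        by (simp add: sums_dominate_def sum.distrib sum_distrib_left)
    qed
    then show "a *\<^sub>R x + b *\<^sub>R y \<in> W"
      using m by (auto simp: W_def)
  qed
  moreover have "(\<Union>x\<in>A \<union> B. (\<lambda>y. x + y) ` nonneg_orthant) \<subseteq> W"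
  proof safe
    fix x y :: "real ^ 3" assume y: "y \<in> nonneg_orthant"
    show "x + y \<in> W" if "x \<in> A"
      using up[OF A[OF that] y] by (auto simp: W_def intro!: exI[of _ 1])
    show "x + y \<in> W" if "x \<in> B"
      using up[OF B[OF that] y] by (auto simp: W_def intro!: exI[of _ 0])
  qed
  ultimately have "newton_polyhedron (A \<union> B) \<subseteq> W"
    unfolding newton_polyhedron_def by (intro hull_minimal)
  with v that show thesis by (auto simp: W_def)
qed

section \<open>Inequalities between exponential sums\<close>

text \<open>Tangent lines at the \<open>v\<close>s reduce the claim to a sum of the differences
  \<open>v - w\<close> weighted by the decreasing \<open>g1, g2, g3\<close>; Abel summation rewrites
  it through differences of partial sums, which are nonnegative.\<close>

lemma exp_sum_weak_majorization_sorted: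
  fixes u :: real
  assumes "0 < u" "v1 \<le> v2" "v2 \<le> v3"
    and "w1 \<le> v1" "w1 + w2 \<le> v1 + v2" "w1 + w2 + w3 \<le> v1 + v2 + v3"
  shows "exp (- u * v1) + exp (- u * v2) + exp (- u * v3) \<le> exp (- u * w1) + exp (- u * w2) + exp (- u * w3)"
proof -
  have tangent: "exp (- u * v) + u * (exp (- u * v) * (v - w)) \<le> exp (- u * w)" for v w
  proof -
    have "exp (- u * v) * (1 + u * (v - w)) \<le> exp (- u * v) * exp (u * (v - w))"
      by (intro mult_left_mono exp_ge_add_one_self) auto
    then show ?thesis by (simp add: exp_add[symmetric] algebra_simps)
  qed
  define g1 g2 g3 where g_def: "g1 = exp (- u * v1)" "g2 = exp (- u * v2)" "g3 = exp (- u * v3)"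
  have g: "g2 \<le> g1" "g3 \<le> g2" "0 \<le> g3"
    using assms(1-3) by (auto simp: g_def)
  have "0 \<le> (g1 - g2) * (v1 - w1) + (g2 - g3) * (v1 + v2 - (w1 + w2)) + g3 * (v1 + v2 + v3 - (w1 + w2 + w3))"
    using assms g by (intro add_nonneg_nonneg mult_nonneg_nonneg) auto
  also have "\<dots> = g1 * (v1 - w1) + g2 * (v2 - w2) + g3 * (v3 - w3)"
    by (simp add: algebra_simps)
  finally have "0 \<le> u * (g1 * (v1 - w1) + g2 * (v2 - w2) + g3 * (v3 - w3))"
    using assms(1) by simp
  then have "0 \<le> u * (g1 * (v1 - w1)) + u * (g2 * (v2 - w2)) + u * (g3 * (v3 - w3))"
    by (simp add: distrib_left)
  then show ?thesis
    using tangent[of v1 w1] tangent[of v2 w2] tangent[of v3 w3] by (simp only: g_def)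
qed

lemma exp_sum_weak_majorization:
  fixes u :: real
  assumes u: "0 < u" and dom: "sums_dominate w1 (w1 + w2) (w1 + w2 + w3) (vector [v1, v2, v3])"
  shows "exp (- u * v1) + exp (- u * v2) + exp (- u * v3) \<le> exp (- u * w1) + exp (- u * w2) + exp (- u * w3)"
proof -
  note M = exp_sum_weak_majorization_sorted[OF u, where ?w1.0 = w1 and ?w2.0 = w2 and ?w3.0 = w3]
  consider "v1 \<le> v2 \<and> v2 \<le> v3" | "v1 \<le> v3 \<and> v3 \<le> v2" | "v2 \<le> v1 \<and> v1 \<le> v3"
    | "v2 \<le> v3 \<and> v3 \<le> v1" | "v3 \<le> v1 \<and> v1 \<le> v2" | "v3 \<le> v2 \<and> v2 \<le> v1" by linarith
  then show ?thesis
    using dom M[of v1 v2 v3] M[of v1 v3 v2] M[of v2 v1 v3] M[of v2 v3 v1] M[of v3 v1 v2] M[of v3 v2 v1]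
    unfolding sums_dominate_vector by cases (simp_all add: add_ac)
qed

lemma exp_convex_comb_le:
  fixes x y l :: real
  assumes "0 \<le> l" "l \<le> 1"
  shows "exp (l * x + (1 - l) * y) \<le> l * exp x + (1 - l) * exp y"
proof -
  define z where "z = l * x + (1 - l) * y"
  have *: "exp z * (1 + (t - z)) \<le> exp t" for t
    using mult_left_mono[OF exp_ge_add_one_self[of "t - z"], of "exp z"]
    by (simp add: exp_add[symmetric])
  have "exp z = l * (exp z * (1 + (x - z))) + (1 - l) * (exp z * (1 + (y - z)))"
    unfolding z_def by (simp add: algebra_simps)
  also have "\<dots> \<le> l * exp x + (1 - l) * exp y"
    using assms * by (intro add_mono mult_left_mono) auto
  finally show ?thesis unfolding z_def .
qed

text \<open>\<open>c\<close> and \<open>a1 + a2 - c\<close> are the convex combinations of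
  \<open>a1, a2\<close> with weights \<open>l\<close> and \<open>1 - l\<close> interchanged, so the
  two convexity bounds add up to the claim.\<close>

lemma exp_sum_le_opposite_shift:
  fixes u l a1 a2 :: real
  assumes "0 \<le> l" "l \<le> 1"
  defines "c \<equiv> l * a1 + (1 - l) * a2"
  shows "exp (- u * c) + exp (- u * (a1 + a2 - c)) \<le> exp (- u * a1) + exp (- u * a2)"
  using exp_convex_comb_le[OF assms(1,2), of "- u * a1" "- u * a2"]
    exp_convex_comb_le[OF assms(1,2), of "- u * a2" "- u * a1"]
  by (simp add: c_def algebra_simps)

text \<open>With \<open>s = exp (- (u / 2))\<close> the claim reads
  \<open>C * (1 - s) \<le> X1 * (1 - p) + X2 * (1 - q)\<close>. Convexity bounds \<open>C\<close>,
  \<open>p\<close> and \<open>q\<close> from above, and with these bounds inserted both sides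
  agree.\<close>

lemma exp_sum_le_half_shift:
  fixes u l a1 a2 :: real
  assumes l: "0 \<le> l" "l \<le> 1" and u: "0 < u"
  defines "c \<equiv> l * a1 + (1 - l) * a2"
  shows "exp (- u * c) + exp (- u * (a1 + l / 2)) + exp (- u * (a2 + (1 - l) / 2))
           \<le> exp (- u * a1) + exp (- u * a2) + exp (- u * (c + 1/2))"
proof -
  define X1 X2 s p q C where defs: "X1 = exp (- u * a1)" "X2 = exp (- u * a2)" "s = exp (- (u / 2))"
    "p = exp (- (u * l / 2))" "q = exp (- (u * (1 - l) / 2))" "C = exp (- u * c)"
  have p: "p \<le> l * s + (1 - l)"
    using exp_convex_comb_le[OF l, of "- (u / 2)" 0] by (simp add: defs mult.commute)
  have q: "q \<le> l + (1 - l) * s"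
    using exp_convex_comb_le[OF l, of 0 "- (u / 2)"] by (simp add: defs mult.commute)
  have C: "C \<le> l * X1 + (1 - l) * X2"
    using exp_convex_comb_le[OF l, of "- u * a1" "- u * a2"] by (simp add: defs c_def algebra_simps)
  have pos: "0 \<le> X1" "0 \<le> X2" "0 \<le> 1 - s" using u by (auto simp: defs)
  have "C * (1 - s) \<le> (l * X1 + (1 - l) * X2) * (1 - s)"
    using C pos by (intro mult_right_mono)
  also have "\<dots> = X1 * (1 - (l * s + (1 - l))) + X2 * (1 - (l + (1 - l) * s))"
    by (simp add: algebra_simps)
  also have "\<dots> \<le> X1 * (1 - p) + X2 * (1 - q)"
    using p q pos by (intro add_mono mult_left_mono) auto
  finally have "C + X1 * p + X2 * q \<le> X1 + X2 + C * s"
    by (simp add: algebra_simps)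
  moreover have "exp (- u * (a1 + l / 2)) = X1 * p" "exp (- u * (a2 + (1 - l) / 2)) = X2 * q"
    "exp (- u * (c + 1/2)) = C * s"
    by (simp_all add: defs exp_add[symmetric] algebra_simps add_divide_distrib diff_divide_distrib)
  ultimately show ?thesis by (simp add: defs)
qed

section \<open>Recovering a permutation from a factored cubic\<close>

lemma vector_permutation_mem_coord_permutations:
  fixes p1 p2 p3 :: real
  shows "{vector [p1, p2, p3], vector [p1, p3, p2], vector [p2, p1, p3], vector [p2, p3, p1],
          vector [p3, p1, p2], vector [p3, p2, p1]} \<subseteq> coord_permutations (vector [p1, p2, p3])"
proof -
  have mem: "vector [v $ j1, v $ j2, v $ j3] \<in> coord_permutations v"
    if "j1 \<noteq> j2" "j1 \<noteq> j3" "j2 \<noteq> j3" for v :: "real ^ 3" and j1 j2 j3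
  proof -
    let ?p = "\<lambda>i::3. if i = 1 then j1 else if i = 2 then j2 else j3"
    have "inj ?p"
      using that unfolding inj_def forall_3 by simp
    with finite_UNIV_inj_surj[OF finite this] have "bij ?p"
      unfolding bij_def by (rule conjI[rotated])
    moreover have "vector [v $ j1, v $ j2, v $ j3] = (\<chi> i. v $ ?p i)"
      by (simp add: vec_eq_iff forall_3)
    ultimately show ?thesis
      unfolding coord_permutations_def by (intro CollectI exI[of _ ?p] conjI)
  qed
  from mem[of 1 2 3 "vector [p1, p2, p3]"] mem[of 1 3 2 "vector [p1, p2, p3]"]
    mem[of 2 1 3 "vector [p1, p2, p3]"] mem[of 2 3 1 "vector [p1, p2, p3]"]
    mem[of 3 1 2 "vector [p1, p2, p3]"] mem[of 3 2 1 "vector [p1, p2, p3]"]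
  show ?thesis by simp
qed

text \<open>Unique factorization by hand: \<open>- b1\<close> is a root of the right side, so
  \<open>b1\<close> equals some \<open>p\<close>; cancelling that factor leaves a quadratic, settled
  by its sum and product of roots.\<close>

lemma coord_permutations_of_poly_eq:
  fixes b1 b2 b3 p1 p2 p3 :: real
  assumes eq: "[:b1, 1:] * [:b2, 1:] * [:b3, 1:] = [:p1, 1:] * [:p2, 1:] * [:p3, 1:]"
  shows "vector [b1, b2, b3] \<in> coord_permutations (vector [p1, p2, p3])"
proof -
  have two: "(b2 = x \<and> b3 = y) \<or> (b2 = y \<and> b3 = x)"
    if "[:b2, 1:] * [:b3, 1:] = [:x, 1:] * [:y, 1:]" for x y :: real
  proof -
    from that have s: "b2 + b3 = x + y" and p: "b2 * b3 = x * y"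
      by (simp_all add: mult.commute add.commute)
    have "(b2 - x) * (b2 - y) = b2 * b2 - b2 * (x + y) + x * y"
      by (simp add: algebra_simps)
    also have "\<dots> = 0"
      unfolding s[symmetric] p[symmetric] by (simp add: algebra_simps)
    finally show ?thesis using s by auto
  qed
  have "poly ([:p1, 1:] * [:p2, 1:] * [:p3, 1:]) (- b1) = 0"
    unfolding eq[symmetric] by (simp only: poly_mult) simp
  then have "b1 = p1 \<or> b1 = p2 \<or> b1 = p3"
    by (simp only: poly_mult mult_eq_0_iff) auto
  then have "(b1 = p1 \<and> [:b2, 1:] * [:b3, 1:] = [:p2, 1:] * [:p3, 1:]) \<or>
      (b1 = p2 \<and> [:b2, 1:] * [:b3, 1:] = [:p1, 1:] * [:p3, 1:]) \<or>
      (b1 = p3 \<and> [:b2, 1:] * [:b3, 1:] = [:p1, 1:] * [:p2, 1:])"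
  proof (elim disjE)
    assume "b1 = p1"
    then have "[:p1, 1:] * ([:b2, 1:] * [:b3, 1:]) = [:p1, 1:] * ([:p2, 1:] * [:p3, 1:])"
      using eq by (simp only: mult_ac)
    then show ?thesis using \<open>b1 = p1\<close> by (subst (asm) mult_cancel_left) simp
  next
    assume "b1 = p2"
    then have "[:p2, 1:] * ([:b2, 1:] * [:b3, 1:]) = [:p2, 1:] * ([:p1, 1:] * [:p3, 1:])"
      using eq by (simp only: mult_ac)
    then show ?thesis using \<open>b1 = p2\<close> by (subst (asm) mult_cancel_left) simp
  next
    assume "b1 = p3"
    then have "[:p3, 1:] * ([:b2, 1:] * [:b3, 1:]) = [:p3, 1:] * ([:p1, 1:] * [:p2, 1:])"
      using eq by (simp only: mult_ac)
    then show ?thesis using \<open>b1 = p3\<close> by (subst (asm) mult_cancel_left) simp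
  qed
  then show ?thesis
    using two vector_permutation_mem_coord_permutations[of p1 p2 p3] by blast
qed

section \<open>Positivity\<close>

lemma hyp2F3_nonneg_of_exp_sum_le:
  fixes a1 a2 b1 b2 b3 c x :: real
  assumes a: "0 < a1" "0 < a2" and b: "0 < b1" "0 < b2" "0 < b3" and c: "0 < c" and x: "0 < x"
    and le: "\<And>u. 0 < u \<Longrightarrow> exp (- u * c) + exp (- u * b1) + exp (- u * b2) + exp (- u * b3)
               \<le> exp (- u * a1) + exp (- u * a2) + exp (- u * (c + 1/2)) + exp (- u * (2 * c))"
  shows "0 \<le> hyp2F3 a1 a2 b1 b2 b3 (- x\<^sup>2)"
    and "hyp2F3 a1 a2 b1 b2 b3 (- x\<^sup>2) = 0 \<Longrightarrow>
      vector [b1, b2, b3] \<in> coord_permutations (vector [a2, a1 + 1/2, 2 * a1])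
        \<union> coord_permutations (vector [a1, a2 + 1/2, 2 * a2])"
proof -
  \<comment> \<open>The parameters \<open>c + 1/2\<close>, \<open>2 * c\<close> and \<open>c\<close>
    cancel those of the square series \<open>f\<close>, leaving the terms of \<open>hyp2F3\<close>
    in \<open>f n * R n\<close>.\<close>
  define \<alpha> \<beta> where "\<alpha> = nth [a1, a2, c + 1/2, 2 * c]" and "\<beta> = nth [c, b1, b2, b3]"
  define I where "I = {..<4::nat}"
  have I: "I = {0, 1, 2, 3}" by (auto simp: I_def)
  have fin: "finite I" by (simp add: I)
  have \<alpha>: "0 < \<alpha> j" if "j \<in> I" for j using that a c by (auto simp: I \<alpha>_def)
  have \<beta>: "0 < \<beta> j" if "j \<in> I" for j using that b c by (auto simp: I \<beta>_def)
  define R where "R = pochhammer_ratio I \<alpha> \<beta>"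
  have mp: "moment_positive R"
    unfolding R_def
    by (rule moment_positive_pochhammer_ratio[OF fin \<alpha> \<beta>])
       (use le in \<open>simp_all add: I \<alpha>_def \<beta>_def add_ac\<close>)
  define e where "e = (\<lambda>n. (- (x\<^sup>2) / 4) ^ n / (fact n * pochhammer (c + 1/2) n))"
  define f where "f = (\<lambda>n. pochhammer c n / (fact n * pochhammer (c + 1/2) n * pochhammer (2 * c) n) * (- (x\<^sup>2)) ^ n)"
  have sm: "summable (\<lambda>n. \<bar>f n\<bar>)" and sq: "(\<Sum>n. f n * t ^ n) = (\<Sum>n. e n * t ^ n)\<^sup>2"
    and sme: "summable (\<lambda>n. \<bar>e n * t ^ n\<bar>)" for t
    using square_0F1[OF c, of "x\<^sup>2"] unfolding e_def f_def by blast+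
  have "hyp2F3 a1 a2 b1 b2 b3 (- x\<^sup>2) = (\<Sum>n. f n * R n)"
  proof -
    have "pochhammer c n > 0" "pochhammer (c + 1/2) n > 0" "pochhammer (2 * c) n > 0" for n
      using c by (simp_all add: pochhammer_pos)
    then have "f n * R n = (pochhammer a1 n * pochhammer a2 n) /
            (fact n * pochhammer b1 n * pochhammer b2 n * pochhammer b3 n) * (- x\<^sup>2) ^ n" for n
      by (simp add: f_def R_def pochhammer_ratio_def I \<alpha>_def \<beta>_def less_imp_neq[THEN not_sym] mult_ac)
    then show ?thesis by (simp add: hyp2F3_def)
  qed
  note hyp = this
  show "0 \<le> hyp2F3 a1 a2 b1 b2 b3 (- x\<^sup>2)"
    unfolding hyp by (rule moment_positiveD[OF mp sm]) (simp add: sq)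
  assume "hyp2F3 a1 a2 b1 b2 b3 (- x\<^sup>2) = 0"
  then have zero: "(\<Sum>n. f n * pochhammer_ratio I \<alpha> \<beta> n) = 0"
    unfolding hyp R_def .
  have e0: "e 0 \<noteq> 0" by (simp add: e_def)
  obtain \<delta> where \<delta>: "0 < \<delta>" "\<delta> < 1" "\<And>t. t \<in> {1 - \<delta>..<1} \<Longrightarrow> (\<Sum>n. e n * t ^ n) \<noteq> 0"
    using power_series_nonzero_left_of_1[OF sme e0] by blast
  have cont: "continuous_on {0..1} (\<lambda>t. \<Sum>n. f n * t ^ n)"
    unfolding sq
  proof (intro continuous_on_power continuous_at_imp_continuous_on ballI)
    show "isCont (\<lambda>t. \<Sum>n. e n * t ^ n) t" for t
      by (rule isCont_powser_converges_everywhere)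
         (use summable_norm_cancel[of "\<lambda>n. e n * _ ^ n"] sme in simp)
  qed
  have prod: "(\<Prod>j\<in>I. \<alpha> j + y) = (\<Prod>j\<in>I. \<beta> j + y)" for y
    by (rule pochhammer_ratio_zero_functional[OF fin \<alpha> \<beta> mp[unfolded R_def] sm zero _ cont \<delta>(1,2)])
       (use \<delta>(3) in \<open>auto simp: sq\<close>)
  have "poly ([:c, 1:] * ([:b1, 1:] * [:b2, 1:] * [:b3, 1:])) y =
        poly ([:a1, 1:] * [:a2, 1:] * [:c + 1/2, 1:] * [:2 * c, 1:]) y" for y
    using prod[of y] by (simp only: poly_mult) (simp add: I \<alpha>_def \<beta>_def mult_ac add_ac)
  then have eq: "[:c, 1:] * ([:b1, 1:] * [:b2, 1:] * [:b3, 1:]) =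
        [:a1, 1:] * [:a2, 1:] * [:c + 1/2, 1:] * [:2 * c, 1:]"
    by (rule poly_ext)
  \<comment> \<open>At \<open>- c\<close> the factors from \<open>c + 1/2\<close> and
    \<open>2 * c\<close> take the nonzero values \<open>1/2\<close> and \<open>c\<close>, so
    \<open>c\<close> must be \<open>a1\<close> or \<open>a2\<close>.\<close>
  have "poly ([:a1, 1:] * [:a2, 1:] * [:c + 1/2, 1:] * [:2 * c, 1:]) (- c) = 0"
    unfolding eq[symmetric] by (simp only: poly_mult) simp
  then have "c = a1 \<or> c = a2"
    using c by (simp only: poly_mult mult_eq_0_iff) auto
  then show "vector [b1, b2, b3] \<in> coord_permutations (vector [a2, a1 + 1/2, 2 * a1])
        \<union> coord_permutations (vector [a1, a2 + 1/2, 2 * a2])"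
  proof
    assume "c = a1"
    then have "[:a1, 1:] * ([:b1, 1:] * [:b2, 1:] * [:b3, 1:]) =
        [:a1, 1:] * ([:a2, 1:] * [:a1 + 1/2, 1:] * [:2 * a1, 1:])"
      using eq by (simp only: mult_ac)
    then have "[:b1, 1:] * [:b2, 1:] * [:b3, 1:] = [:a2, 1:] * [:a1 + 1/2, 1:] * [:2 * a1, 1:]"
      by (subst (asm) mult_cancel_left) simp
    then show ?thesis using coord_permutations_of_poly_eq by blast
  next
    assume "c = a2"
    then have "[:a2, 1:] * ([:b1, 1:] * [:b2, 1:] * [:b3, 1:]) =
        [:a2, 1:] * ([:a1, 1:] * [:a2 + 1/2, 1:] * [:2 * a2, 1:])"
      using eq by (simp only: mult_ac)
    then have "[:b1, 1:] * [:b2, 1:] * [:b3, 1:] = [:a1, 1:] * [:a2 + 1/2, 1:] * [:2 * a2, 1:]"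
      by (subst (asm) mult_cancel_left) simp
    then show ?thesis using coord_permutations_of_poly_eq by blast
  qed
qed

section \<open>From the polyhedron to the exponential inequality\<close>

text \<open>The cases differ in whether \<open>a2\<close> or \<open>a1 + 1/2\<close> is the least
  entry of the points of \<open>A\<close>; after majorization they end with
  \<open>exp_sum_le_opposite_shift\<close> and \<open>exp_sum_le_half_shift\<close>
  respectively.\<close>

lemma newton_polyhedron_exp_sum_le:
  fixes a1 a2 b1 b2 b3 :: real
  assumes a: "0 < a1" "a1 < a2" "a2 \<le> 2 * a1" "a1 < 1/2 \<Longrightarrow> a2 \<le> 1/2"
    and mem: "vector [b1, b2, b3] \<in> newton_polyhedron
        (coord_permutations (vector [a2, a1 + 1/2, 2 * a1]) \<union> coord_permutations (vector [a1, a2 + 1/2, 2 * a2]))"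
  obtains c where "0 < c" "0 < b1" "0 < b2" "0 < b3"
    "\<And>u. 0 < u \<Longrightarrow> exp (- u * c) + exp (- u * b1) + exp (- u * b2) + exp (- u * b3)
        \<le> exp (- u * a1) + exp (- u * a2) + exp (- u * (c + 1/2)) + exp (- u * (2 * c))"
proof -
  have cpos: "0 < l * x + (1 - l) * y" if "0 \<le> l" "l \<le> 1" "0 < x" "0 < y" for l x y :: real
  proof (cases "l = 0")
    case False
    then show ?thesis using that by (intro add_pos_nonneg mult_pos_pos mult_nonneg_nonneg) auto
  qed (use that in simp)
  show thesis
  proof (cases "a2 \<le> a1 + 1/2")
    case True
    have A: "sums_dominate a2 (a2 + min (2 * a1) (a1 + 1/2)) (a2 + 2 * a1 + (a1 + 1/2)) x"
      if "x \<in> coord_permutations (vector [a2, a1 + 1/2, 2 * a1])" for x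
      by (rule sums_dominate_coord_permutations[OF _ that])
         (use a True in \<open>auto simp: sums_dominate_vector\<close>)
    have B: "sums_dominate a1 (a1 + min (2 * a2) (a2 + 1/2)) (a1 + 2 * a2 + (a2 + 1/2)) x"
      if "x \<in> coord_permutations (vector [a1, a2 + 1/2, 2 * a2])" for x
      by (rule sums_dominate_coord_permutations[OF _ that])
         (use a True in \<open>auto simp: sums_dominate_vector\<close>)
    obtain l where l: "0 \<le> l" "l \<le> 1"
      "sums_dominate (l * a2 + (1 - l) * a1)
         (l * (a2 + min (2 * a1) (a1 + 1/2)) + (1 - l) * (a1 + min (2 * a2) (a2 + 1/2)))
         (l * (a2 + 2 * a1 + (a1 + 1/2)) + (1 - l) * (a1 + 2 * a2 + (a2 + 1/2))) (vector [b1, b2, b3])"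
      by (rule newton_polyhedron_sums_dominate[OF mem A B])
    define c where "c = l * a1 + (1 - l) * a2"
    have c: "0 < c" using cpos[OF l(1,2), of a1 a2] a by (simp add: c_def)
    have w1: "l * a2 + (1 - l) * a1 = a1 + a2 - c" by (simp add: c_def algebra_simps)
    define m M where "m = min (2 * c) (c + 1/2)" and "M = max (2 * c) (c + 1/2)"
    \<comment> \<open>\<open>min (2 * z) (z + 1/2)\<close> is affine in \<open>z\<close> on either
      side of 1/2. By hypothesis \<open>a1\<close>, \<open>a2\<close> and hence \<open>c\<close> lie
      on one side, so it commutes with the convex combination.\<close>
    have "l * min (2 * a1) (a1 + 1/2) + (1 - l) * min (2 * a2) (a2 + 1/2) = m"
    proof (cases "a1 < 1/2")
      case True
      then have "a2 \<le> 1/2" using a by simp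
      moreover have "c \<le> 1/2"
        unfolding c_def using True \<open>a2 \<le> 1/2\<close> l convex_bound_le[of a1 "1/2" a2 l "1 - l"] by simp
      ultimately show ?thesis using True by (simp add: m_def c_def min_def algebra_simps)
    next
      case False
      moreover have "- c \<le> - (1/2)"
        unfolding c_def using False a l convex_bound_le[of "- a1" "- (1/2)" "- a2" l "1 - l"] by simp
      ultimately have "min (2 * a1) (a1 + 1/2) = a1 + 1/2" "min (2 * a2) (a2 + 1/2) = a2 + 1/2"
          "m = c + 1/2"
        using a by (auto simp: m_def)
      then show ?thesis by (simp only: c_def) (simp add: algebra_simps flip: add_divide_distrib)
    qed
    then have w2: "l * (a2 + min (2 * a1) (a1 + 1/2)) + (1 - l) * (a1 + min (2 * a2) (a2 + 1/2)) = a1 + a2 - c + m"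
      using w1 by (simp add: algebra_simps)
    have "m + M = 2 * c + (c + 1/2)" by (simp add: m_def M_def)
    then have w3: "l * (a2 + 2 * a1 + (a1 + 1/2)) + (1 - l) * (a1 + 2 * a2 + (a2 + 1/2)) = a1 + a2 - c + m + M"
      by (simp add: c_def algebra_simps diff_divide_distrib)
    have dom: "sums_dominate (a1 + a2 - c) (a1 + a2 - c + m) (a1 + a2 - c + m + M) (vector [b1, b2, b3])"
      using l(3) unfolding w1 w2 w3 .
    have "0 < a1 + a2 - c"
      using cpos[OF l(1,2), of a2 a1] a by (simp add: w1)
    with dom have b: "0 < b1" "0 < b2" "0 < b3"
      by (auto simp: sums_dominate_vector)
    show thesis
    proof (rule that[OF c b])
      fix u :: real assume u: "0 < u"
      \<comment> \<open>In either order these two terms cancel on the right of the goal, leaving the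
        opposite shift inequality.\<close>
      have "exp (- u * m) + exp (- u * M) = exp (- u * (2 * c)) + exp (- u * (c + 1/2))"
        by (auto simp: m_def M_def min_def max_def)
      with exp_sum_weak_majorization[OF u dom] exp_sum_le_opposite_shift[OF l(1,2), of u a1 a2]
      show "exp (- u * c) + exp (- u * b1) + exp (- u * b2) + exp (- u * b3)
        \<le> exp (- u * a1) + exp (- u * a2) + exp (- u * (c + 1/2)) + exp (- u * (2 * c))"
        unfolding c_def[symmetric] by linarith
    qed
  next
    case False
    \<comment> \<open>From \<open>a1 + 1/2 < a2\<close> and \<open>a2 \<le> 2 * a1\<close>.\<close>
    then have "1/2 \<le> a1" using a by linarith
    have A: "sums_dominate (a1 + 1/2) (a1 + 1/2 + a2) (a1 + 1/2 + a2 + 2 * a1) x"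
      if "x \<in> coord_permutations (vector [a2, a1 + 1/2, 2 * a1])" for x
      by (rule sums_dominate_coord_permutations[OF _ that])
         (use a False \<open>1/2 \<le> a1\<close> in \<open>auto simp: sums_dominate_vector\<close>)
    have B: "sums_dominate a1 (a1 + (a2 + 1/2)) (a1 + (a2 + 1/2) + 2 * a2) x"
      if "x \<in> coord_permutations (vector [a1, a2 + 1/2, 2 * a2])" for x
      by (rule sums_dominate_coord_permutations[OF _ that])
         (use a False \<open>1/2 \<le> a1\<close> in \<open>auto simp: sums_dominate_vector\<close>)
    obtain l where l: "0 \<le> l" "l \<le> 1"
      "sums_dominate (l * (a1 + 1/2) + (1 - l) * a1)
         (l * (a1 + 1/2 + a2) + (1 - l) * (a1 + (a2 + 1/2)))
         (l * (a1 + 1/2 + a2 + 2 * a1) + (1 - l) * (a1 + (a2 + 1/2) + 2 * a2)) (vector [b1, b2, b3])"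
      by (rule newton_polyhedron_sums_dominate[OF mem A B])
    define c where "c = l * a1 + (1 - l) * a2"
    have c: "0 < c" using cpos[OF l(1,2), of a1 a2] a by (simp add: c_def)
    define w1 w2 where "w1 = a1 + l / 2" and "w2 = a2 + (1 - l) / 2"
    txt \<open>
      Here \<open>A\<close> and \<open>B\<close> are ordered differently: sorted increasingly they are
      \<open>(a1 + 1/2, a2, 2 a1)\<close> and \<open>(a1, a2 + 1/2, 2 a2)\<close>.
    \<close>
    have dom: "sums_dominate w1 (w1 + w2) (w1 + w2 + 2 * c) (vector [b1, b2, b3])"
    proof -
      have "l * (a1 + 1/2) + (1 - l) * a1 = w1"
        "l * (a1 + 1/2 + a2) + (1 - l) * (a1 + (a2 + 1/2)) = w1 + w2"
        "l * (a1 + 1/2 + a2 + 2 * a1) + (1 - l) * (a1 + (a2 + 1/2) + 2 * a2) = w1 + w2 + 2 * c"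
        by (simp_all add: w1_def w2_def c_def field_simps)
      with l(3) show ?thesis by simp
    qed
    have "0 < w1" using l a by (simp add: w1_def)
    with dom have b: "0 < b1" "0 < b2" "0 < b3"
      by (auto simp: sums_dominate_vector)
    show thesis
    proof (rule that[OF c b])
      fix u :: real assume u: "0 < u"
      from exp_sum_weak_majorization[OF u dom] exp_sum_le_half_shift[OF l(1,2) u, of a1 a2]
      show "exp (- u * c) + exp (- u * b1) + exp (- u * b2) + exp (- u * b3)
        \<le> exp (- u * a1) + exp (- u * a2) + exp (- u * (c + 1/2)) + exp (- u * (2 * c))"
        unfolding c_def[symmetric] w1_def w2_def by linarith
    qed
  qed
qed

theorem theorem8p1:
  fixes a1 a2 b1 b2 b3 :: real and A B :: "(real ^ 3) set"
  assumes "a1 > 0" and "a2 > 0"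
    and "if a1 < 1/2
         then a1 < a2 \<and> a2 \<le> min (2 * a1) (1/2)
         else a1 < a2 \<and> a2 \<le> min (2 * a1) (3/2 * (a1 + 1/2))"
    and "A = coord_permutations (vector [a2, a1 + 1/2, 2 * a1])"
    and "B = coord_permutations (vector [a1, a2 + 1/2, 2 * a2])"
    and "vector [b1, b2, b3] \<in> newton_polyhedron (A \<union> B)"
  shows "(\<forall>x>0. hyp2F3 a1 a2 b1 b2 b3 (- x\<^sup>2) \<ge> 0) \<and>
         (vector [b1, b2, b3] \<notin> A \<union> B \<longrightarrow>
            (\<forall>x>0. hyp2F3 a1 a2 b1 b2 b3 (- x\<^sup>2) > 0))"
proof -
  have a: "a1 < a2" "a2 \<le> 2 * a1" "a1 < 1/2 \<Longrightarrow> a2 \<le> 1/2"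
    using assms(3) by (auto split: if_splits)
  obtain c where c: "0 < c" "0 < b1" "0 < b2" "0 < b3"
    "\<And>u. 0 < u \<Longrightarrow> exp (- u * c) + exp (- u * b1) + exp (- u * b2) + exp (- u * b3)
        \<le> exp (- u * a1) + exp (- u * a2) + exp (- u * (c + 1/2)) + exp (- u * (2 * c))"
    using newton_polyhedron_exp_sum_le[OF assms(1) a assms(6)[unfolded assms(4,5)]] by blast
  note hyp = hyp2F3_nonneg_of_exp_sum_le[OF assms(1,2) c(2-4) c(1) _ c(5)]
  \<comment> \<open>Off \<open>A \<union> B\<close> a zero is impossible, so the nonnegative value
    is positive.\<close>
  show ?thesis
    using hyp unfolding assms(4,5) by (simp add: less_le) (metis UnE)
qed

end
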